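(* Let $(\Gamma,L,M)$ be an uncertainty space and let $(p_k)_{k\ge1}$ be positive real numbers with $P_n=\sum_{k=1}^n p_k$. Then the sequence spaces $f_R$, $m_R$ and $e_R$ of uncertain variables on $(\Gamma,L,M)$ are linearly isomorphic to the spaces $f$, $m$ and $e$, respectively; that is, there exist linear bijections $f_R\to f$, $m_R\to m$ and $e_R\to e$.
   Context: An uncertainty space $(\Gamma,L,M)$ (in the sense of Liu) consists of a nonempty set $\Gamma$, a $\sigma$-algebra $L$ on $\Gamma$, and an uncertain measure $M:L\to[0,1]$, i.e. a set function with $M(\Gamma)=1$, $M(A)+M(\Gamma\setminus A)=1$ for all $A\in L$, and $M(\bigcup_i A_i)\le\sum_i M(A_i)$ for every countable family $(A_i)$ in $L$. An uncertain variable is a measurable function $\Gamma\to\mathbb{R}$. The expected value of an uncertain variable $\xi$ is $E[\xi]=\int_0^\infty M(\xi\ge r)\,dr-\int_{-\infty}^0 M(\xi\le r)\,dr$, provided at least one of the integrals is finite. The spaces are sets of sequences $(\xi_n)_{n\ge1}$ of uncertain variables, with termwise and pointwise addition and real scalar multiplication: - $f$: there are an uncertain variable $\xi$ and $\Lambda\in L$ with $M(\Lambda)=1$ such that $\lim_{n\to\infty}|\xi_n(\gamma)-\xi(\gamma)|=0$ for all $\gamma\in\Lambda$; - $m$: there is an uncertain variable $\xi$ such that $\lim_{n\to\infty}M(|\xi_n-\xi|\ge\varepsilon)=0$ for all $\varepsilon>0$; - $e$: there is an uncertain variable $\xi$ such that $\lim_{n\to\infty}E[|\xi_n-\xi|]=0$.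 The spaces $f_R$, $m_R$, $e_R$ consist of the sequences $(\xi_n)_{n\ge1}$ of uncertain variables whose sequence of Riesz means $\nu_n=\sum_{i=1}^n\frac{p_i}{P_n}\xi_i$ ($n\ge1$) belongs to $f$, $m$, $e$, respectively. *)

theory Defs
  imports "HOL-Analysis.Analysis" "HOL-Library.Function_Algebras"
begin

text \<open>Pointwise scalar multiplication, complementing the pointwise addition of
  \<^theory>\<open>HOL-Library.Function_Algebras\<close>.  Sequences of real functions, of type
  \<^typ>\<open>nat \<Rightarrow> 'a \<Rightarrow> real\<close>, thereby carry the termwise and pointwise operations.\<close>

instantiation "fun" :: (type, real_vector) real_vector
begin

definition scaleR_fun :: "real \<Rightarrow> ('a \<Rightarrow> 'b) \<Rightarrow> 'a \<Rightarrow> 'b"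
  where "scaleR_fun c f = (\<lambda>x. c *\<^sub>R f x)"

instance
  by standard (simp_all add: scaleR_fun_def plus_fun_def scaleR_add_left scaleR_add_right)

end

locale uncertainty_space = sigma_algebra \<Gamma> L
  for \<Gamma> :: "'a set" and L :: "'a set set" +
  fixes M :: "'a set \<Rightarrow> real"
  assumes space_nonempty: "\<Gamma> \<noteq> {}"
    and range_M: "A \<in> L \<Longrightarrow> 0 \<le> M A \<and> M A \<le> 1"
    and normality: "M \<Gamma> = 1"
    and duality: "A \<in> L \<Longrightarrow> M A + M (\<Gamma> - A) = 1"
     \<comment> \<open>The series is taken in \<^typ>\<open>ennreal\<close>, since it may diverge.  Finite families are
      covered by padding with the empty set, which has measure 0 by duality.\<close>
    and subadditivity: "range B \<subseteq> L \<Longrightarrow> ennreal (M (\<Union>i. B i)) \<le> (\<Sum>i::nat. ennreal (M (B i)))"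

text \<open>A function on \<open>\<Gamma>\<close> is represented by its extension by 0 to the whole type, so that functions
  on \<open>\<Gamma>\<close> correspond one-to-one to their representatives and the operations are preserved.  Only the
  measurable structure of \<^term>\<open>sigma \<Gamma> L\<close> is used.\<close>

definition uncertain_vars :: "'a set \<Rightarrow> 'a set set \<Rightarrow> ('a \<Rightarrow> real) set" where
  "uncertain_vars \<Gamma> L = {\<xi> \<in> borel_measurable (sigma \<Gamma> L). \<forall>\<gamma>. \<gamma> \<notin> \<Gamma> \<longrightarrow> \<xi> \<gamma> = 0}"

text \<open>Sequences are indexed by \<open>n \<ge> 1\<close>; by the same convention the unused entry 0 is zero.\<close>

definition uncertain_seqs :: "'a set \<Rightarrow> 'a set set \<Rightarrow> (nat \<Rightarrow> 'a \<Rightarrow> real) set" where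
  "uncertain_seqs \<Gamma> L = {\<xi>. \<xi> 0 = 0 \<and> (\<forall>n\<ge>1. \<xi> n \<in> uncertain_vars \<Gamma> L)}"

text \<open>The expected value is meaningful when at least one of the two integrals is finite.  This
  always holds for the nonnegative variables to which it is applied below: there the second integral
  is 0, and the expected value lies in \<open>[0, \<infinity>]\<close>.\<close>

definition expected_value :: "'a set \<Rightarrow> ('a set \<Rightarrow> real) \<Rightarrow> ('a \<Rightarrow> real) \<Rightarrow> ereal" where
  "expected_value \<Gamma> M \<xi> =
     enn2ereal (\<integral>\<^sup>+r\<in>{0..}. ennreal (M {\<gamma> \<in> \<Gamma>. \<xi> \<gamma> \<ge> r}) \<partial>lborel) -
     enn2ereal (\<integral>\<^sup>+r\<in>{..0}. ennreal (M {\<gamma> \<in> \<Gamma>. \<xi> \<gamma> \<le> r}) \<partial>lborel)"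

definition f_space ::
  "'a set \<Rightarrow> 'a set set \<Rightarrow> ('a set \<Rightarrow> real) \<Rightarrow> (nat \<Rightarrow> 'a \<Rightarrow> real) set" where
  "f_space \<Gamma> L M = {\<xi> \<in> uncertain_seqs \<Gamma> L.
     \<exists>\<eta>\<in>uncertain_vars \<Gamma> L. \<exists>\<Lambda>\<in>L. M \<Lambda> = 1 \<and> (\<forall>\<gamma>\<in>\<Lambda>. (\<lambda>n. \<bar>\<xi> n \<gamma> - \<eta> \<gamma>\<bar>) \<longlonglongrightarrow> 0)}"

definition m_space ::
  "'a set \<Rightarrow> 'a set set \<Rightarrow> ('a set \<Rightarrow> real) \<Rightarrow> (nat \<Rightarrow> 'a \<Rightarrow> real) set" where
  "m_space \<Gamma> L M = {\<xi> \<in> uncertain_seqs \<Gamma> L.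
     \<exists>\<eta>\<in>uncertain_vars \<Gamma> L. \<forall>\<epsilon>>0. (\<lambda>n. M {\<gamma> \<in> \<Gamma>. \<bar>\<xi> n \<gamma> - \<eta> \<gamma>\<bar> \<ge> \<epsilon>}) \<longlonglongrightarrow> 0}"

definition e_space ::
  "'a set \<Rightarrow> 'a set set \<Rightarrow> ('a set \<Rightarrow> real) \<Rightarrow> (nat \<Rightarrow> 'a \<Rightarrow> real) set" where
  "e_space \<Gamma> L M = {\<xi> \<in> uncertain_seqs \<Gamma> L.
     \<exists>\<eta>\<in>uncertain_vars \<Gamma> L. (\<lambda>n. expected_value \<Gamma> M (\<lambda>\<gamma>. \<bar>\<xi> n \<gamma> - \<eta> \<gamma>\<bar>)) \<longlonglongrightarrow> 0}"

definition riesz_mean :: "(nat \<Rightarrow> real) \<Rightarrow> (nat \<Rightarrow> 'a \<Rightarrow> real) \<Rightarrow> nat \<Rightarrow> 'a \<Rightarrow> real" where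
  "riesz_mean p \<xi> n = (\<lambda>\<gamma>. \<Sum>i=1..n. p i / (\<Sum>k=1..n. p k) * \<xi> i \<gamma>)"

definition riesz_space ::
  "'a set \<Rightarrow> 'a set set \<Rightarrow> (nat \<Rightarrow> real) \<Rightarrow> (nat \<Rightarrow> 'a \<Rightarrow> real) set \<Rightarrow> (nat \<Rightarrow> 'a \<Rightarrow> real) set" where
  "riesz_space \<Gamma> L p X = {\<xi> \<in> uncertain_seqs \<Gamma> L. riesz_mean p \<xi> \<in> X}"

text \<open>A linear isomorphism is required only on the spaces themselves, not on the ambient type; that
  the two sets are linear spaces is part of the notion.\<close>

definition linearly_isomorphic :: "'v::real_vector set \<Rightarrow> 'w::real_vector set \<Rightarrow> bool" where
  "linearly_isomorphic V W \<longleftrightarrow> subspace V \<and> subspace W \<and>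
     (\<exists>T. bij_betw T V W \<and>
        (\<forall>x\<in>V. \<forall>y\<in>V. T (x + y) = T x + T y) \<and>
        (\<forall>c. \<forall>x\<in>V. T (c *\<^sub>R x) = c *\<^sub>R T x))"

end

theory Submission
  imports Defs
begin

text \<open>
  The isomorphism is the Riesz mean transform \<^term>\<open>riesz_mean p\<close> itself.  It is linear, and on
  \<^term>\<open>uncertain_seqs \<Gamma> L\<close> it can be inverted without losing measurability, because its
  matrix is lower triangular with nonzero diagonal: with \<open>P\<^sub>n = p\<^sub>1 + \<dots> + p\<^sub>n\<close> and \<open>\<nu>\<close> the
  sequence of means, \<open>p\<^sub>n \<xi>\<^sub>n = P\<^sub>n \<nu>\<^sub>n - P\<^sub>n\<^sub>-\<^sub>1 \<nu>\<^sub>n\<^sub>-\<^sub>1\<close>.  Since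
  \<^term>\<open>riesz_space \<Gamma> L p X\<close> is the preimage of \<open>X\<close>, the transform restricts to a bijection onto \<open>X\<close> for every
  linear space \<open>X\<close> of uncertain sequences (lemma \<open>linearly_isomorphic_riesz_space\<close>).

  What depends on the mode of convergence is only that the target is a linear space.  In each
  case the sequences that converge to 0 form a linear space, and adding the constant sequences
  preserves this (lemma \<open>subspace_convergent_seqs\<close>).  An uncertain measure is in general neither
  additive nor continuous, but duality and subadditivity give monotonicity, and with
  \<open>{\<bar>X + Y\<bar> \<ge> r} \<subseteq> {\<bar>X\<bar> \<ge> r/2} \<union> {\<bar>Y\<bar> \<ge> r/2}\<close> this suffices for convergence in measure.
  The expected value need not be subadditive either, but integrating the same inclusion over \<open>r\<close>
  yields \<open>E[\<bar>X + Y\<bar>] \<le> 2 E[\<bar>X\<bar>] + 2 E[\<bar>Y\<bar>]\<close>, which is enough for limits equal to 0.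
\<close>

section \<open>The Riesz mean transform\<close>

lemma scaleR_fun_apply: "(c *\<^sub>R f) x = c *\<^sub>R f x"
  by (simp add: scaleR_fun_def)

lemma riesz_mean_0 [simp]: "riesz_mean p \<xi> 0 = 0"
  by (simp add: riesz_mean_def fun_eq_iff)

lemma riesz_mean_add: "riesz_mean p (\<xi> + \<eta>) = riesz_mean p \<xi> + riesz_mean p \<eta>"
  by (simp add: riesz_mean_def fun_eq_iff sum.distrib distrib_left add_divide_distrib)

lemma riesz_mean_scaleR: "riesz_mean p (c *\<^sub>R \<xi>) = c *\<^sub>R riesz_mean p \<xi>"
  by (simp add: riesz_mean_def fun_eq_iff scaleR_fun_def sum_distrib_left mult_ac)

lemma linear_riesz_mean: "linear (riesz_mean p)"
  by (intro linearI riesz_mean_add riesz_mean_scaleR)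

lemma uncertain_vars_add:
  "\<xi> \<in> uncertain_vars \<Gamma> L \<Longrightarrow> \<eta> \<in> uncertain_vars \<Gamma> L \<Longrightarrow> \<xi> + \<eta> \<in> uncertain_vars \<Gamma> L"
  by (auto simp: uncertain_vars_def plus_fun_def)

lemma uncertain_vars_scaleR: "\<xi> \<in> uncertain_vars \<Gamma> L \<Longrightarrow> c *\<^sub>R \<xi> \<in> uncertain_vars \<Gamma> L"
  by (auto simp: uncertain_vars_def scaleR_fun_def)

lemma subspace_uncertain_vars: "subspace (uncertain_vars \<Gamma> L)"
  unfolding subspace_def
  by (auto intro: uncertain_vars_add uncertain_vars_scaleR) (simp add: uncertain_vars_def zero_fun_def)

lemma subspace_uncertain_seqs: "subspace (uncertain_seqs \<Gamma> L)"
  by (auto simp: subspace_def uncertain_seqs_def scaleR_fun_apply simp flip: zero_fun_def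
      intro: uncertain_vars_add uncertain_vars_scaleR subspace_0[OF subspace_uncertain_vars])

lemma uncertain_seqs_nth: "\<xi> \<in> uncertain_seqs \<Gamma> L \<Longrightarrow> \<xi> n \<in> uncertain_vars \<Gamma> L"
  using subspace_0[OF subspace_uncertain_vars, of \<Gamma> L]
  by (cases n) (auto simp: uncertain_seqs_def)

lemma weighted_riesz_mean:
  fixes p :: "nat \<Rightarrow> real"
  assumes pos: "\<And>k. k \<ge> 1 \<Longrightarrow> p k > 0"
  shows "(\<Sum>k=1..n. p k) * riesz_mean p \<xi> n \<gamma> = (\<Sum>i=1..n. p i * \<xi> i \<gamma>)"
proof (cases "n = 0")
  case False
  then have "(\<Sum>k=1..n. p k) > 0"
    by (intro sum_pos) (auto intro: pos)
  then show ?thesis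
    by (simp add: riesz_mean_def sum_distrib_left)
qed simp

definition riesz_inverse :: "(nat \<Rightarrow> real) \<Rightarrow> (nat \<Rightarrow> 'a \<Rightarrow> real) \<Rightarrow> nat \<Rightarrow> 'a \<Rightarrow> real" where
  "riesz_inverse p \<nu> n = (if n = 0 then 0 else
     (1 / p n) *\<^sub>R ((\<Sum>k=1..n. p k) *\<^sub>R \<nu> n - (\<Sum>k=1..n - 1. p k) *\<^sub>R \<nu> (n - 1)))"

lemma riesz_inverse_in_uncertain_seqs:
  assumes "\<nu> \<in> uncertain_seqs \<Gamma> L"
  shows "riesz_inverse p \<nu> \<in> uncertain_seqs \<Gamma> L"
  unfolding uncertain_seqs_def riesz_inverse_def
  by (auto intro!: subspace_scale subspace_diff subspace_uncertain_vars uncertain_seqs_nth[OF assms])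

lemma riesz_inverse_riesz_mean:
  assumes pos: "\<And>k. k \<ge> 1 \<Longrightarrow> p k > 0" and "\<xi> 0 = 0"
  shows "riesz_inverse p (riesz_mean p \<xi>) = \<xi>"
proof (intro ext)
  fix n \<gamma>
  show "riesz_inverse p (riesz_mean p \<xi>) n \<gamma> = \<xi> n \<gamma>"
  proof (cases n)
    case 0
    then show ?thesis using assms by (simp add: riesz_inverse_def)
  next
    case (Suc m)
    have "riesz_inverse p (riesz_mean p \<xi>) n \<gamma>
        = 1 / p n * ((\<Sum>k=1..n. p k) * riesz_mean p \<xi> n \<gamma> - (\<Sum>k=1..m. p k) * riesz_mean p \<xi> m \<gamma>)"
      unfolding riesz_inverse_def using Suc by (simp add: scaleR_fun_def)
    also have "\<dots> = 1 / p n * ((\<Sum>i=1..n. p i * \<xi> i \<gamma>) - (\<Sum>i=1..m. p i * \<xi> i \<gamma>))"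
      by (simp only: weighted_riesz_mean[OF pos])
    also have "\<dots> = \<xi> n \<gamma>"
      using pos[of n] Suc by simp
    finally show ?thesis .
  qed
qed

lemma riesz_mean_riesz_inverse:
  assumes pos: "\<And>k. k \<ge> 1 \<Longrightarrow> p k > 0" and "\<nu> 0 = 0"
  shows "riesz_mean p (riesz_inverse p \<nu>) = \<nu>"
proof (intro ext)
  fix n \<gamma>
  have telescope: "(\<Sum>i=1..n. p i * riesz_inverse p \<nu> i \<gamma>) = (\<Sum>k=1..n. p k) * \<nu> n \<gamma>"
  proof (induction n)
    case (Suc n)
    have "p (Suc n) \<noteq> 0" using pos[of "Suc n"] by simp
    then have "p (Suc n) * riesz_inverse p \<nu> (Suc n) \<gamma>
        = (\<Sum>k=1..Suc n. p k) * \<nu> (Suc n) \<gamma> - (\<Sum>k=1..n. p k) * \<nu> n \<gamma>"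
      by (simp add: riesz_inverse_def scaleR_fun_def)
    then show ?case using Suc.IH by simp
  qed simp
  show "riesz_mean p (riesz_inverse p \<nu>) n \<gamma> = \<nu> n \<gamma>"
  proof (cases "n = 0")
    case False
    then have "(\<Sum>k=1..n. p k) > 0"
      by (intro sum_pos) (auto intro: pos)
    moreover have "(\<Sum>k=1..n. p k) * riesz_mean p (riesz_inverse p \<nu>) n \<gamma>
        = (\<Sum>k=1..n. p k) * \<nu> n \<gamma>"
      using weighted_riesz_mean[OF pos] telescope by (rule trans)
    ultimately show ?thesis by simp
  qed (simp add: assms)
qed

lemma linearly_isomorphic_riesz_space:
  assumes pos: "\<And>k. k \<ge> 1 \<Longrightarrow> p k > 0"
    and X: "subspace X" "X \<subseteq> uncertain_seqs \<Gamma> L"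
  shows "linearly_isomorphic (riesz_space \<Gamma> L p X) X"
proof -
  have "riesz_space \<Gamma> L p X = uncertain_seqs \<Gamma> L \<inter> riesz_mean p -` X"
    by (auto simp: riesz_space_def)
  then have "subspace (riesz_space \<Gamma> L p X)"
    by (simp add: subspace_inter subspace_uncertain_seqs
        linear_subspace_vimage[OF linear_riesz_mean X(1)])
  moreover have "bij_betw (riesz_mean p) (riesz_space \<Gamma> L p X) X"
  proof (rule bij_betw_byWitness[where f' = "riesz_inverse p"])
    show "\<forall>\<xi>\<in>riesz_space \<Gamma> L p X. riesz_inverse p (riesz_mean p \<xi>) = \<xi>"
      by (auto simp: riesz_space_def uncertain_seqs_def intro: riesz_inverse_riesz_mean[OF pos])
    have inv: "riesz_mean p (riesz_inverse p \<nu>) = \<nu>" if "\<nu> \<in> X" for \<nu>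
      using that X(2) by (intro riesz_mean_riesz_inverse[OF pos]) (auto simp: uncertain_seqs_def)
    then show "\<forall>\<nu>\<in>X. riesz_mean p (riesz_inverse p \<nu>) = \<nu>" by blast
    show "riesz_mean p ` riesz_space \<Gamma> L p X \<subseteq> X"
      by (auto simp: riesz_space_def)
    show "riesz_inverse p ` X \<subseteq> riesz_space \<Gamma> L p X"
      using X(2) inv by (auto simp: riesz_space_def intro: riesz_inverse_in_uncertain_seqs)
  qed
  ultimately show ?thesis
    unfolding linearly_isomorphic_def using X(1) riesz_mean_add riesz_mean_scaleR by blast
qed

section \<open>From null sequences to convergent sequences\<close>

text \<open>If \<open>\<xi> - \<eta>\<close> and \<open>\<xi>' - \<eta>'\<close> are null, then so is \<open>(\<xi> + \<xi>') - (\<eta> + \<eta>')\<close>.  The entry 0 of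
  \<open>\<xi> - \<eta>\<close> is \<open>-\<eta>\<close>, so null sequences are not confined to \<^const>\<open>uncertain_seqs\<close>.\<close>

lemma subspace_convergent_seqs:
  assumes zero: "null (\<lambda>n. 0)"
    and add: "\<And>X Y. range X \<subseteq> uncertain_vars \<Gamma> L \<Longrightarrow> range Y \<subseteq> uncertain_vars \<Gamma> L \<Longrightarrow>
      null X \<Longrightarrow> null Y \<Longrightarrow> null (\<lambda>n. X n + Y n)"
    and scale: "\<And>c X. range X \<subseteq> uncertain_vars \<Gamma> L \<Longrightarrow> null X \<Longrightarrow> null (\<lambda>n. c *\<^sub>R X n)"
  shows "subspace {\<xi> \<in> uncertain_seqs \<Gamma> L. \<exists>\<eta>\<in>uncertain_vars \<Gamma> L. null (\<lambda>n. \<xi> n - \<eta>)}"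
    (is "subspace ?S")
proof (rule subspaceI)
  have range: "range (\<lambda>n. \<xi> n - \<eta>) \<subseteq> uncertain_vars \<Gamma> L"
    if "\<xi> \<in> uncertain_seqs \<Gamma> L" "\<eta> \<in> uncertain_vars \<Gamma> L" for \<xi> \<eta>
    by (intro image_subsetI subspace_diff[OF subspace_uncertain_vars uncertain_seqs_nth[OF that(1)] that(2)])
  show "0 \<in> ?S"
    using zero subspace_0[OF subspace_uncertain_seqs] subspace_0[OF subspace_uncertain_vars]
    by (auto intro!: bexI[of _ 0])
  fix \<xi> assume "\<xi> \<in> ?S"
  then obtain \<eta> where \<xi>: "\<xi> \<in> uncertain_seqs \<Gamma> L" "\<eta> \<in> uncertain_vars \<Gamma> L" "null (\<lambda>n. \<xi> n - \<eta>)"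
    by blast
  show "c *\<^sub>R \<xi> \<in> ?S" for c
  proof -
    have "null (\<lambda>n. c *\<^sub>R (\<xi> n - \<eta>))"
      by (intro scale range \<xi>)
    then have "null (\<lambda>n. (c *\<^sub>R \<xi>) n - c *\<^sub>R \<eta>)"
      by (simp add: scaleR_diff_right scaleR_fun_def[of c \<xi>])
    then show ?thesis
      using \<xi> by (auto intro: subspace_scale subspace_uncertain_seqs uncertain_vars_scaleR)
  qed
  fix \<xi>' assume "\<xi>' \<in> ?S"
  then obtain \<eta>' where \<xi>': "\<xi>' \<in> uncertain_seqs \<Gamma> L" "\<eta>' \<in> uncertain_vars \<Gamma> L"
    "null (\<lambda>n. \<xi>' n - \<eta>')" by blast
  have "null (\<lambda>n. (\<xi> n - \<eta>) + (\<xi>' n - \<eta>'))"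
    by (intro add range \<xi> \<xi>')
  then have "null (\<lambda>n. (\<xi> + \<xi>') n - (\<eta> + \<eta>'))"
    by (simp add: algebra_simps)
  then show "\<xi> + \<xi>' \<in> ?S"
    using \<xi> \<xi>' by (auto intro: subspace_add subspace_uncertain_seqs uncertain_vars_add)
qed

section \<open>Uncertain measures and the three modes of convergence\<close>

text \<open>Substitution \<open>r = c s\<close>; it turns the tails of \<open>c X\<close> into tails of \<open>X\<close>.\<close>

lemma nn_integral_halfline_divide:
  fixes g :: "real \<Rightarrow> ennreal"
  assumes "c > 0" and [measurable]: "g \<in> borel_measurable borel"
  shows "(\<integral>\<^sup>+r\<in>{0..}. g (r / c) \<partial>lborel) = ennreal c * (\<integral>\<^sup>+r\<in>{0..}. g r \<partial>lborel)"
proof -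
  have "(\<integral>\<^sup>+r\<in>{0..}. g (r / c) \<partial>lborel)
      = ennreal \<bar>c\<bar> * (\<integral>\<^sup>+s. g ((0 + c * s) / c) * indicator {0..} (0 + c * s) \<partial>lborel)"
    using assms by (intro nn_integral_real_affine) auto
  also have "(\<integral>\<^sup>+s. g ((0 + c * s) / c) * indicator {0..} (0 + c * s) \<partial>lborel)
      = (\<integral>\<^sup>+r\<in>{0..}. g r \<partial>lborel)"
    using assms(1)
    by (intro nn_integral_cong) (auto simp: indicator_def zero_le_mult_iff)
  finally show ?thesis using assms(1) by simp
qed

context uncertainty_space
begin

lemma M_empty: "M {} = 0"
  using duality[of \<Gamma>] normality by simp

lemma M_Un_le:
  assumes "A \<in> L" "B \<in> L"
  shows "M (A \<union> B) \<le> M A + M B"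
proof -
  have "ennreal (M (\<Union>i. binaryset A B i)) \<le> (\<Sum>i. ennreal (M (binaryset A B i)))"
    using assms by (intro subadditivity) (auto simp: range_binaryset_eq)
  also have "\<dots> = ennreal (M A) + ennreal (M B)"
    by (rule suminf_binaryset_eq) (simp add: M_empty)
  also have "\<dots> = ennreal (M A + M B)"
    using range_M assms by simp
  finally have "ennreal (M (A \<union> B)) \<le> ennreal (M A + M B)"
    by (simp only: UN_binaryset_eq)
  then show ?thesis
    using range_M assms by (subst (asm) ennreal_le_iff) auto
qed

text \<open>As \<open>\<Gamma> = (\<Gamma> - A) \<union> B\<close>, subadditivity and duality give \<open>1 \<le> (1 - M A) + M B\<close>.\<close>

lemma M_mono:
  assumes "A \<in> L" "B \<in> L" "A \<subseteq> B"
  shows "M A \<le> M B"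
proof -
  have "(\<Gamma> - A) \<union> B = \<Gamma>"
    using assms sets_into_space by blast
  then have "1 \<le> M (\<Gamma> - A) + M B"
    using M_Un_le[of "\<Gamma> - A" B] assms normality by auto
  then show ?thesis using duality[OF assms(1)] by simp
qed

lemma M_Int_eq_1:
  assumes "A \<in> L" "B \<in> L" "M A = 1" "M B = 1"
  shows "M (A \<inter> B) = 1"
proof -
  have "M (\<Gamma> - A \<inter> B) \<le> M (\<Gamma> - A) + M (\<Gamma> - B)"
    unfolding Diff_Int using assms by (intro M_Un_le) auto
  then have "M (\<Gamma> - A \<inter> B) \<le> 0"
    using duality[of A] duality[of B] assms by simp
  then show ?thesis
    using duality[OF Int[OF assms(1,2)]] range_M[OF Int[OF assms(1,2)]] by linarith
qed

abbreviation tail :: "('a \<Rightarrow> real) \<Rightarrow> real \<Rightarrow> 'a set" where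
  "tail X r \<equiv> {\<gamma> \<in> \<Gamma>. r \<le> \<bar>X \<gamma>\<bar>}"

lemma tail_in_L:
  assumes "X \<in> uncertain_vars \<Gamma> L"
  shows "tail X r \<in> L"
proof -
  have [measurable]: "X \<in> borel_measurable (sigma \<Gamma> L)"
    using assms by (simp add: uncertain_vars_def)
  have "{\<gamma> \<in> space (sigma \<Gamma> L). r \<le> \<bar>X \<gamma>\<bar>} \<in> sets (sigma \<Gamma> L)"
    by measurable
  then show ?thesis
    by simp
qed

lemma M_tail_nonneg: "X \<in> uncertain_vars \<Gamma> L \<Longrightarrow> 0 \<le> M (tail X r)"
  using range_M[OF tail_in_L] by blast

lemma tail_scaleR: "c \<noteq> 0 \<Longrightarrow> tail (c *\<^sub>R X) r = tail X (r / \<bar>c\<bar>)"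
  by (auto simp: scaleR_fun_def abs_mult field_simps)

lemma tail_zero: "r > 0 \<Longrightarrow> tail 0 r = {}"
  by auto

lemma M_tail_add:
  assumes "X \<in> uncertain_vars \<Gamma> L" "Y \<in> uncertain_vars \<Gamma> L"
  shows "M (tail (X + Y) r) \<le> M (tail X (r / 2)) + M (tail Y (r / 2))"
proof -
  have "M (tail (X + Y) r) \<le> M (tail X (r / 2) \<union> tail Y (r / 2))"
    using assms by (intro M_mono Un tail_in_L uncertain_vars_add) auto
  also have "\<dots> \<le> M (tail X (r / 2)) + M (tail Y (r / 2))"
    using assms by (intro M_Un_le tail_in_L)
  finally show ?thesis .
qed

text \<open>By monotonicity the function is decreasing in \<open>r\<close>, hence Borel.\<close>

lemma measurable_M_tail:
  assumes "X \<in> uncertain_vars \<Gamma> L"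
  shows "(\<lambda>r. ennreal (M (tail X r))) \<in> borel_measurable borel"
proof -
  have "mono (\<lambda>r. - M (tail X r))"
    using assms by (intro monoI) (auto intro!: M_mono tail_in_L)
  then have "(\<lambda>r. - M (tail X r)) \<in> borel_measurable borel"
    by (rule borel_measurable_mono)
  then have "(\<lambda>r. - (- M (tail X r))) \<in> borel_measurable borel"
    by (rule borel_measurable_uminus)
  then show ?thesis by simp
qed

definition tail_integral :: "('a \<Rightarrow> real) \<Rightarrow> ennreal" where
  "tail_integral X = (\<integral>\<^sup>+r\<in>{0..}. ennreal (M (tail X r)) \<partial>lborel)"

text \<open>For a nonnegative variable the integrand of the second integral is supported at \<open>r = 0\<close>.\<close>

lemma expected_value_abs: "expected_value \<Gamma> M (\<lambda>\<gamma>. \<bar>X \<gamma>\<bar>) = enn2ereal (tail_integral X)"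
proof -
  have "AE r in lborel. ennreal (M {\<gamma> \<in> \<Gamma>. \<bar>X \<gamma>\<bar> \<le> r}) * indicator {..0} r = 0"
    using AE_lborel_singleton[of 0]
  proof eventually_elim
    case (elim r)
    have "M {\<gamma> \<in> \<Gamma>. \<bar>X \<gamma>\<bar> \<le> r} = 0" if "r < 0"
    proof -
      have "{\<gamma> \<in> \<Gamma>. \<bar>X \<gamma>\<bar> \<le> r} = {}"
        using that by (auto simp: not_le intro: less_le_trans)
      then show ?thesis by (simp only: M_empty)
    qed
    then show ?case
      using elim by (cases "r < 0") (auto simp: indicator_def)
  qed
  then have "(\<integral>\<^sup>+r\<in>{..0}. ennreal (M {\<gamma> \<in> \<Gamma>. \<bar>X \<gamma>\<bar> \<le> r}) \<partial>lborel) = (\<integral>\<^sup>+(r::real). 0 \<partial>lborel)"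
    by (rule nn_integral_cong_AE)
  then show ?thesis
    by (simp add: expected_value_def tail_integral_def zero_ennreal.rep_eq)
qed

text \<open>The tail of the zero function is all of \<open>\<Gamma>\<close> at \<open>r = 0\<close> and empty for \<open>r > 0\<close>.\<close>

lemma tail_integral_zero: "tail_integral 0 = 0"
proof -
  have "AE r in lborel. ennreal (M (tail 0 r)) * indicator {0..} r = 0"
    using AE_lborel_singleton[of 0]
  proof eventually_elim
    case (elim r)
    then show ?case
      using tail_zero[of r] by (cases "r > 0") (auto simp: M_empty indicator_def)
  qed
  then have "tail_integral 0 = (\<integral>\<^sup>+(r::real). 0 \<partial>lborel)"
    unfolding tail_integral_def by (rule nn_integral_cong_AE)
  then show ?thesis by simp
qed

lemma tail_integral_scaleR:
  assumes "X \<in> uncertain_vars \<Gamma> L"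
  shows "tail_integral (c *\<^sub>R X) = ennreal \<bar>c\<bar> * tail_integral X"
proof (cases "c = 0")
  case False
  then show ?thesis
    using nn_integral_halfline_divide[OF _ measurable_M_tail[OF assms], of "\<bar>c\<bar>"]
    by (simp add: tail_integral_def tail_scaleR)
qed (simp add: tail_integral_zero)

text \<open>The substitution \<open>r = 2 s\<close> in the two halved tails produces the factors 2.\<close>

lemma tail_integral_add:
  assumes "X \<in> uncertain_vars \<Gamma> L" "Y \<in> uncertain_vars \<Gamma> L"
  shows "tail_integral (X + Y) \<le> 2 * tail_integral X + 2 * tail_integral Y"
proof -
  note [measurable] = assms[THEN measurable_M_tail]
  have "tail_integral (X + Y)
      \<le> (\<integral>\<^sup>+r. ennreal (M (tail X (r / 2))) * indicator {0..} r
            + ennreal (M (tail Y (r / 2))) * indicator {0..} r \<partial>lborel)"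
    unfolding tail_integral_def
  proof (rule nn_integral_mono)
    fix r :: real
    have "ennreal (M (tail (X + Y) r)) \<le> ennreal (M (tail X (r / 2)) + M (tail Y (r / 2)))"
      by (intro ennreal_leI M_tail_add assms)
    also have "\<dots> = ennreal (M (tail X (r / 2))) + ennreal (M (tail Y (r / 2)))"
      by (intro ennreal_plus M_tail_nonneg assms)
    finally show "ennreal (M (tail (X + Y) r)) * indicator {0..} r
        \<le> ennreal (M (tail X (r / 2))) * indicator {0..} r
          + ennreal (M (tail Y (r / 2))) * indicator {0..} r"
      by (auto simp: indicator_def)
  qed
  also have "\<dots> = (\<integral>\<^sup>+r\<in>{0..}. ennreal (M (tail X (r / 2))) \<partial>lborel)
      + (\<integral>\<^sup>+r\<in>{0..}. ennreal (M (tail Y (r / 2))) \<partial>lborel)"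
    by (intro nn_integral_add) measurable
  also have "\<dots> = 2 * tail_integral X + 2 * tail_integral Y"
    using nn_integral_halfline_divide[OF _ measurable_M_tail[OF assms(1)], of 2]
      nn_integral_halfline_divide[OF _ measurable_M_tail[OF assms(2)], of 2]
    by (simp add: tail_integral_def)
  finally show ?thesis .
qed

text \<open>Two sets of measure 1 meet in a set of measure 1, on which both sequences converge.\<close>

lemma subspace_f_space: "subspace (f_space \<Gamma> L M)"
proof -
  define null where
    "null X \<longleftrightarrow> (\<exists>\<Lambda>\<in>L. M \<Lambda> = 1 \<and> (\<forall>\<gamma>\<in>\<Lambda>. (\<lambda>n. X n \<gamma>) \<longlonglongrightarrow> 0))" for X :: "nat \<Rightarrow> 'a \<Rightarrow> real"
  have "f_space \<Gamma> L M = {\<xi> \<in> uncertain_seqs \<Gamma> L. \<exists>\<eta>\<in>uncertain_vars \<Gamma> L. null (\<lambda>n. \<xi> n - \<eta>)}"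
    by (simp add: f_space_def null_def tendsto_rabs_zero_iff)
  also have "subspace \<dots>"
  proof (rule subspace_convergent_seqs)
    show "null (\<lambda>n. 0)"
      unfolding null_def using normality by (auto intro!: bexI[of _ \<Gamma>])
    show "null (\<lambda>n. c *\<^sub>R X n)" if "null X" for c X
      using that unfolding null_def
      by (auto simp: scaleR_fun_def intro: tendsto_mult_right_zero elim!: bexI[rotated])
    show "null (\<lambda>n. X n + Y n)" if "null X" "null Y" for X Y
    proof -
      obtain A where A: "A \<in> L" "M A = 1" "\<forall>\<gamma>\<in>A. (\<lambda>n. X n \<gamma>) \<longlonglongrightarrow> 0"
        using \<open>null X\<close> unfolding null_def by blast
      obtain B where B: "B \<in> L" "M B = 1" "\<forall>\<gamma>\<in>B. (\<lambda>n. Y n \<gamma>) \<longlonglongrightarrow> 0"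
        using \<open>null Y\<close> unfolding null_def by blast
      show ?thesis
        unfolding null_def using A B
        by (intro bexI[of _ "A \<inter> B"]) (auto intro: M_Int_eq_1 tendsto_add_zero)
    qed
  qed
  finally show ?thesis .
qed

lemma subspace_m_space: "subspace (m_space \<Gamma> L M)"
proof -
  define null where
    "null X \<longleftrightarrow> (\<forall>\<epsilon>>0. (\<lambda>n. M (tail (X n) \<epsilon>)) \<longlonglongrightarrow> 0)" for X :: "nat \<Rightarrow> 'a \<Rightarrow> real"
  have "m_space \<Gamma> L M = {\<xi> \<in> uncertain_seqs \<Gamma> L. \<exists>\<eta>\<in>uncertain_vars \<Gamma> L. null (\<lambda>n. \<xi> n - \<eta>)}"
    by (simp add: m_space_def null_def)
  also have "subspace \<dots>"
  proof (rule subspace_convergent_seqs)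
    show zero: "null (\<lambda>n. 0)"
      by (simp add: null_def tail_zero M_empty del: zero_fun_apply)
    show "null (\<lambda>n. c *\<^sub>R X n)" if "null X" for c X
      using that zero
      by (cases "c = 0") (auto simp: null_def tail_scaleR)
    show "null (\<lambda>n. X n + Y n)"
      if "range X \<subseteq> uncertain_vars \<Gamma> L" "range Y \<subseteq> uncertain_vars \<Gamma> L" "null X" "null Y" for X Y
      unfolding null_def
    proof (intro allI impI)
      fix \<epsilon> :: real assume "\<epsilon> > 0"
      have uv: "X n \<in> uncertain_vars \<Gamma> L" "Y n \<in> uncertain_vars \<Gamma> L" for n
        using that by auto
      have "(\<lambda>n. M (tail (X n) (\<epsilon> / 2)) + M (tail (Y n) (\<epsilon> / 2))) \<longlonglongrightarrow> 0"
        using that(3,4) half_gt_zero[OF \<open>\<epsilon> > 0\<close>] unfolding null_def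
        by (intro tendsto_add_zero) blast+
      then show "(\<lambda>n. M (tail (X n + Y n) \<epsilon>)) \<longlonglongrightarrow> 0"
      proof (rule tendsto_sandwich[OF _ _ tendsto_const, rotated 2])
        show "\<forall>\<^sub>F n in sequentially. 0 \<le> M (tail (X n + Y n) \<epsilon>)"
          by (intro always_eventually allI M_tail_nonneg uncertain_vars_add uv)
        show "\<forall>\<^sub>F n in sequentially.
            M (tail (X n + Y n) \<epsilon>) \<le> M (tail (X n) (\<epsilon> / 2)) + M (tail (Y n) (\<epsilon> / 2))"
          using M_tail_add[OF uv] by simp
      qed
    qed
  qed
  finally show ?thesis .
qed

lemma subspace_e_space: "subspace (e_space \<Gamma> L M)"
proof -
  define null where
    "null X \<longleftrightarrow> (\<lambda>n. tail_integral (X n)) \<longlonglongrightarrow> 0" for X :: "nat \<Rightarrow> 'a \<Rightarrow> real"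
  have "(\<lambda>n. expected_value \<Gamma> M (\<lambda>\<gamma>. \<bar>\<xi> n \<gamma> - \<eta> \<gamma>\<bar>)) \<longlonglongrightarrow> 0 \<longleftrightarrow> null (\<lambda>n. \<xi> n - \<eta>)" for \<xi> \<eta>
    using expected_value_abs[of "\<xi> _ - \<eta>"]
      tendsto_enn2ereal_iff[of "\<lambda>n. tail_integral (\<xi> n - \<eta>)" 0 sequentially]
    by (simp add: null_def zero_ennreal.rep_eq)
  then have "e_space \<Gamma> L M
      = {\<xi> \<in> uncertain_seqs \<Gamma> L. \<exists>\<eta>\<in>uncertain_vars \<Gamma> L. null (\<lambda>n. \<xi> n - \<eta>)}"
    by (simp add: e_space_def)
  also have "subspace \<dots>"
  proof (rule subspace_convergent_seqs)
    show "null (\<lambda>n. 0)"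
      by (simp add: null_def tail_integral_zero)
    have mult_null: "(\<lambda>n. ennreal c * f n) \<longlonglongrightarrow> 0" if "f \<longlonglongrightarrow> 0" for c f
      using ennreal_tendsto_cmult[OF _ that, of "ennreal c"] by simp
    show "null (\<lambda>n. c *\<^sub>R X n)" if "range X \<subseteq> uncertain_vars \<Gamma> L" "null X" for c X
    proof -
      have "tail_integral (c *\<^sub>R X n) = ennreal \<bar>c\<bar> * tail_integral (X n)" for n
        using that(1) by (intro tail_integral_scaleR) auto
      then show ?thesis
        using mult_null that(2) by (simp add: null_def)
    qed
    show "null (\<lambda>n. X n + Y n)"
      if "range X \<subseteq> uncertain_vars \<Gamma> L" "range Y \<subseteq> uncertain_vars \<Gamma> L" "null X" "null Y" for X Y
    proof -
      have le: "tail_integral (X n + Y n) \<le> 2 * tail_integral (X n) + 2 * tail_integral (Y n)" for n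
        using that(1,2) by (intro tail_integral_add) auto
      have "(\<lambda>n. 2 * tail_integral (X n) + 2 * tail_integral (Y n)) \<longlonglongrightarrow> 0 + 0"
        using that(3,4) mult_null[of _ 2] by (intro tendsto_add) (auto simp: null_def)
      then have "(\<lambda>n. 2 * tail_integral (X n) + 2 * tail_integral (Y n)) \<longlonglongrightarrow> 0"
        by simp
      then show ?thesis
        unfolding null_def
        by (rule tendsto_sandwich[OF always_eventually always_eventually tendsto_const, rotated 2])
          (use le in auto)
    qed
  qed
  finally show ?thesis .
qed

end

theorem theorem4p4:
  fixes \<Gamma> :: "'a set" and L :: "'a set set" and M :: "'a set \<Rightarrow> real" and p :: "nat \<Rightarrow> real"
  assumes "uncertainty_space \<Gamma> L M"
    and "\<And>k. k \<ge> 1 \<Longrightarrow> p k > 0"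
  shows "linearly_isomorphic (riesz_space \<Gamma> L p (f_space \<Gamma> L M)) (f_space \<Gamma> L M) \<and>
         linearly_isomorphic (riesz_space \<Gamma> L p (m_space \<Gamma> L M)) (m_space \<Gamma> L M) \<and>
         linearly_isomorphic (riesz_space \<Gamma> L p (e_space \<Gamma> L M)) (e_space \<Gamma> L M)"
proof -
  interpret uncertainty_space \<Gamma> L M by fact
  show ?thesis
    by (intro conjI linearly_isomorphic_riesz_space assms(2)
        subspace_f_space subspace_m_space subspace_e_space)
      (auto simp: f_space_def m_space_def e_space_def)
qed

end
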